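(* Let $\mu>0$. There exist constants $C_1'',C_2''>0$ such that for $\nu^{(\mu)}$-almost every tree $T$ there is $r_0(T)\in\mathbb N$ with $$C_1''\,r^3\le|B_r(T)|\le C_2''\,r^3\log r\qquad\text{for all }r\ge r_0(T).$$ In particular $\lim_{r\to\infty}\frac{\ln|B_r(T)|}{\ln r}=3$ for $\nu^{(\mu)}$-a.e. $T$.
   Context: Rooted planar trees; $|D_r(T)|$ = number of vertices at height $r$; $|B_r(T)|=\sum_{s=1}^r|D_s(T)|$. $\nu^{(\mu)}$ ($\mu>0$) is the Borel probability measure on rooted planar trees characterized by $\nu^{(\mu)}(\{T:B_r(T)=T_0\})=e^{-\mu(r-1)}4^{-|T_0|}2^{K+1}\sum_{R=1}^K\binom KR\frac{\mu^{R-1}}{(R-1)!}$ for every finite $T_0$ of height $r$ with $|T_0|$ edges and $K$ vertices at height $r$; it is the weak limit of $\nu_N^{(\mu)}(T)\propto e^{-\mu h(T)}$ on trees with $N$ edges ($h$ = height). *)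

theory Defs
  imports "HOL-Probability.Probability"
begin

definition is_planar_tree :: "nat list set \<Rightarrow> bool" where
  "is_planar_tree T \<longleftrightarrow>
     [] \<in> T \<and>
     (\<forall>v k. v @ [k] \<in> T \<longrightarrow> v \<in> T) \<and>
     (\<forall>v j k. v @ [k] \<in> T \<and> j < k \<longrightarrow> v @ [j] \<in> T) \<and>
     (\<forall>v\<in>T. finite {k. v @ [k] \<in> T})"

definition planar_trees :: "nat list set set" where
  "planar_trees = {T. is_planar_tree T}"

definition vheight :: "nat list \<Rightarrow> nat" where
  "vheight v = length v + 1"

definition level :: "nat \<Rightarrow> nat list set \<Rightarrow> nat list set" where
  "level r T = {v \<in> T. vheight v = r}"

definition ball_tree :: "nat \<Rightarrow> nat list set \<Rightarrow> nat list set" where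
  "ball_tree r T = {v \<in> T. 1 \<le> vheight v \<and> vheight v \<le> r}"

definition tree_height :: "nat list set \<Rightarrow> nat" where
  "tree_height T = Max (vheight ` T)"

definition cylinder :: "nat \<Rightarrow> nat list set \<Rightarrow> nat list set set" where
  "cylinder r T0 = {T \<in> planar_trees. ball_tree r T = T0}"

definition cylinders :: "nat list set set set" where
  "cylinders = {cylinder r T0 | r T0. True}"

definition nu_cyl :: "real \<Rightarrow> nat list set \<Rightarrow> real" where
  "nu_cyl \<mu> T0 =
     (let r = tree_height T0; K = card (level r T0) in
      exp (- \<mu> * (real r - 1)) * (1/4) ^ card T0 * 2 ^ (K + 1) *
      (\<Sum>R = 1..K. real (K choose R) * \<mu> ^ (R - 1) / fact (R - 1)))"

text \<open>M is the measure nu^(mu): a probability measure on the space of planar trees,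
  with the sigma-algebra generated by the cylinder sets, having the given cylinder
  probabilities (which determine it uniquely).\<close>
definition is_nu :: "real \<Rightarrow> nat list set measure \<Rightarrow> bool" where
  "is_nu \<mu> M \<longleftrightarrow>
     prob_space M \<and> space M = planar_trees \<and>
     sets M = sigma_sets planar_trees cylinders \<and>
     (\<forall>T0. is_planar_tree T0 \<and> finite T0 \<longrightarrow>
        measure M (cylinder (tree_height T0) T0) = nu_cyl \<mu> T0)"

end

theory Submission
  imports Defs
begin

text \<open>Only the one-dimensional marginals of the generation sizes \<open>Z\<^sub>n = |D\<^bsub>n+1\<^esub>|\<close> are needed.
  Counting the one-generation extensions of a finite tree by stars and bars shows that
  \<open>(Z\<^sub>n)\<close> is the Doob transform of the critical geometric branching process by a Laguerre
  polynomial; since the iterates of its offspring generating function are Moebius maps, \<open>Z\<^sub>n\<close> has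
  the explicit generating function
  \<open>E s\<^bsup>Z\<^esup> = e\<^bsup>-\<mu>n\<^esup> s / (n+1-ns)\<^sup>2 exp (\<mu>ns / (n+1-ns))\<close>.
  Chernoff bounds at \<open>s = n/(n+1)\<close> and \<open>s = 1 + 1/(2n)\<close> show that \<open>Z\<^sub>n\<close> lies outside
  \<open>[c n\<^sup>2, C n\<^sup>2]\<close> with exponentially small probability. By Borel--Cantelli the generation sizes are
  eventually of order \<open>n\<^sup>2\<close>, so the balls are of exact order \<open>r\<^sup>3\<close>.\<close>

section \<open>Power series: negative binomials and the Laguerre generating function\<close>

text \<open>This is the generalised binomial series with exponent -(m + 1); negating the upper index
  turns its coefficients into ordinary binomials.\<close>

lemma negative_binomial_sums:
  fixes z :: real
  assumes "\<bar>z\<bar> < 1"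
  shows "(\<lambda>j. real ((j + m) choose m) * z ^ j) sums (1 / (1 - z) ^ Suc m)"
proof -
  have coeff: "(- real (Suc m) gchoose j) * (- z) ^ j = real ((j + m) choose m) * z ^ j" for j
  proof -
    have "(real (Suc m) + real j - 1) gchoose j = real ((j + m) choose j)"
      by (simp add: binomial_gbinomial add.commute)
    also have "(j + m) choose j = (j + m) choose m"
      using binomial_symmetric[of j "j + m"] by simp
    finally show ?thesis
      unfolding gbinomial_minus by (simp add: power_mult_distrib[symmetric] mult.commute mult.left_commute)
  qed
  have "(1 + - z) powr (- real (Suc m)) = 1 / (1 - z) ^ Suc m"
    using assms by (subst powr_minus) (simp add: powr_realpow[of "1 - z" "Suc m", simplified] divide_simps)
  then show ?thesis
    using gen_binomial_real[of "- z" "- real (Suc m)"] assms by (simp only: coeff)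
qed

text \<open>A column of Pascal's triangle: the negative binomial series for \<open>Suc i\<close>,
  shifted by i places. The terms with K < i vanish.\<close>

lemma binomial_column_sums:
  fixes x :: real
  assumes "\<bar>x\<bar> < 1"
  shows "(\<lambda>K. real (Suc K choose Suc i) * x ^ K) sums (x ^ i / (1 - x) ^ (i + 2))"
proof -
  have "(\<lambda>j. x ^ i * (real ((j + Suc i) choose Suc i) * x ^ j)) sums (x ^ i * (1 / (1 - x) ^ Suc (Suc i)))"
    by (intro sums_mult negative_binomial_sums assms)
  then have "(\<lambda>j. real (Suc (j + i) choose Suc i) * x ^ (j + i)) sums (x ^ i / (1 - x) ^ (i + 2))"
    by (simp add: power_add mult_ac del: binomial_Suc_Suc)
  then show ?thesis
    by (subst (asm) sums_iff_shift) (simp add: binomial_eq_0 del: binomial_Suc_Suc)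
qed

text \<open>The Laguerre polynomial \<open>L\<^bsub>K-1\<^esub>\<^bsup>(1)\<^esup>\<close> at \<open>-\<mu>\<close>.\<close>

definition lag :: "real \<Rightarrow> nat \<Rightarrow> real" where
  "lag \<mu> K = (\<Sum>R = 1..K. real (K choose R) * \<mu> ^ (R - 1) / fact (R - 1))"

lemma lag_Suc: "lag \<mu> (Suc K) = (\<Sum>i\<le>K. real (Suc K choose Suc i) * \<mu> ^ i / fact i)"
  unfolding lag_def
  by (rule sum.reindex_bij_witness[of _ Suc "\<lambda>i. i - 1"]) auto

lemma lag_nonneg: "\<mu> \<ge> 0 \<Longrightarrow> lag \<mu> K \<ge> 0"
  unfolding lag_def by (intro sum_nonneg) auto

lemma lag_pos:
  assumes "\<mu> > 0" "K \<ge> 1"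
  shows "lag \<mu> K > 0"
  unfolding lag_def using assms by (intro sum_pos) auto

text \<open>Expanding \<open>lag\<close> gives a double series with nonnegative terms. Summing over
  K first leaves the exponential series in \<mu> x / (1 - x). Working in \<open>ennreal\<close>
  makes the interchange unconditional.\<close>

lemma lag_generating_function:
  assumes "\<mu> \<ge> 0" "0 \<le> x" "x < 1"
  shows "(\<Sum>K. ennreal (x ^ K * lag \<mu> (Suc K))) = ennreal (exp (\<mu> * x / (1 - x)) / (1 - x) ^ 2)"
proof -
  define a where "a K i = x ^ K * (real (Suc K choose Suc i) * \<mu> ^ i / fact i)" for K i
  have a_nonneg: "a K i \<ge> 0" for K i
    using assms by (simp add: a_def)
  have row: "ennreal (x ^ K * lag \<mu> (Suc K)) = (\<Sum>i. ennreal (a K i))" for K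
  proof -
    have "(\<lambda>i. a K i) sums (\<Sum>i\<le>K. a K i)"
      by (rule sums_finite) (auto simp: a_def binomial_eq_0 simp del: binomial_Suc_Suc)
    moreover have "(\<Sum>i\<le>K. a K i) = x ^ K * lag \<mu> (Suc K)"
      by (simp add: a_def lag_Suc sum_distrib_left)
    ultimately show ?thesis
      using suminf_ennreal_eq[OF a_nonneg] by simp
  qed
  have column: "(\<Sum>K. ennreal (a K i)) = ennreal (1 / (1 - x) ^ 2 * ((\<mu> * x / (1 - x)) ^ i /\<^sub>R fact i))" for i
  proof -
    have "(\<lambda>K. \<mu> ^ i / fact i * (real (Suc K choose Suc i) * x ^ K))
        sums (\<mu> ^ i / fact i * (x ^ i / (1 - x) ^ (i + 2)))"
      using assms by (intro sums_mult binomial_column_sums) auto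
    moreover have "\<mu> ^ i / fact i * (x ^ i / (1 - x) ^ (i + 2))
        = 1 / (1 - x) ^ 2 * ((\<mu> * x / (1 - x)) ^ i /\<^sub>R fact i)"
      by (simp add: power_add power_mult_distrib power_divide field_simps power2_eq_square)
    ultimately have "(\<lambda>K. a K i) sums (1 / (1 - x) ^ 2 * ((\<mu> * x / (1 - x)) ^ i /\<^sub>R fact i))"
      unfolding a_def by (simp add: mult_ac del: binomial_Suc_Suc)
    then show ?thesis
      by (intro suminf_ennreal_eq a_nonneg)
  qed
  \<comment> \<open>Tonelli's theorem, with one of the two sums read as an integral over the
    counting measure.\<close>
  have "(\<Sum>K. \<Sum>i. ennreal (a K i)) = (\<Sum>i. \<Sum>K. ennreal (a K i))"
    using nn_integral_suminf[of "\<lambda>i K. ennreal (a K i)" "count_space UNIV"]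
    by (simp add: nn_integral_count_space_nat)
  also have "\<dots> = ennreal (1 / (1 - x) ^ 2 * exp (\<mu> * x / (1 - x)))"
    unfolding column using assms
    by (intro suminf_ennreal_eq sums_mult exp_converges mult_nonneg_nonneg) auto
  finally show ?thesis
    by (simp add: row)
qed

section \<open>Levels and balls of planar trees\<close>

text \<open>The definition bounds the children only of vertices of T; closure under parents makes
  the child set empty for every other word, so finiteness holds for all v.\<close>

lemma planar_treeD:
  assumes "is_planar_tree T"
  shows planar_tree_root: "[] \<in> T"
    and planar_tree_parent: "v @ [k] \<in> T \<Longrightarrow> v \<in> T"
    and planar_tree_sibling: "v @ [k] \<in> T \<Longrightarrow> j < k \<Longrightarrow> v @ [j] \<in> T"
    and planar_tree_finite_children: "finite {k. v @ [k] \<in> T}"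
proof -
  have parent: "v @ [k] \<in> T \<Longrightarrow> v \<in> T" for v k
    using assms unfolding is_planar_tree_def by blast
  then show "v @ [k] \<in> T \<Longrightarrow> v \<in> T" .
  show "finite {k. v @ [k] \<in> T}"
  proof (cases "v \<in> T")
    case True
    then show ?thesis using assms unfolding is_planar_tree_def by blast
  next
    case False
    then have "{k. v @ [k] \<in> T} = {}" using parent by blast
    then show ?thesis by simp
  qed
qed (use assms in \<open>unfold is_planar_tree_def, blast+\<close>)

text \<open>The word \<open>[]\<close> has height 1, hence the shift: generation n sits at height n
  + 1, and the ball of radius r consists of the generations n < r.\<close>

lemma level_eq: "level (Suc n) T = {v \<in> T. length v = n}"
  by (auto simp: level_def vheight_def)

lemma ball_tree_eq: "ball_tree r T = {v \<in> T. length v < r}"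
  by (auto simp: ball_tree_def vheight_def)

lemma level_Suc_eq:
  assumes "is_planar_tree T"
  shows "level (Suc (Suc n)) T = (\<Union>v\<in>level (Suc n) T. (\<lambda>k. v @ [k]) ` {k. v @ [k] \<in> T})"
    (is "_ = ?R")
proof (intro equalityI subsetI)
  fix w assume w: "w \<in> level (Suc (Suc n)) T"
  then obtain v k where "w = v @ [k]"
    by (cases w rule: rev_cases) (auto simp: level_eq)
  with w show "w \<in> ?R"
    using planar_tree_parent[OF assms] by (auto simp: level_eq)
qed (auto simp: level_eq)

lemma finite_level:
  assumes "is_planar_tree T"
  shows "finite (level r T)"
proof (cases r)
  case (Suc n)
  have "finite (level (Suc n) T)" for n
  proof (induction n)
    case 0
    have "level (Suc 0) T \<subseteq> {[]}" by (auto simp: level_eq)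
    then show ?case by (rule finite_subset) simp
  next
    case (Suc n)
    then show ?case
      using planar_tree_finite_children[OF assms] by (simp add: level_Suc_eq[OF assms])
  qed
  then show ?thesis using Suc by simp
qed (simp add: level_def vheight_def)

lemma ball_tree_UN_level: "ball_tree r T = (\<Union>n<r. level (Suc n) T)"
  by (auto simp: ball_tree_eq level_eq)

lemma finite_ball_tree: "is_planar_tree T \<Longrightarrow> finite (ball_tree r T)"
  by (simp add: ball_tree_UN_level finite_level)

lemma card_ball_tree:
  assumes "is_planar_tree T"
  shows "card (ball_tree r T) = (\<Sum>n<r. card (level (Suc n) T))"
  unfolding ball_tree_UN_level
  by (intro card_UN_disjoint ballI impI finite_level[OF assms] finite_lessThan) (auto simp: level_eq)

lemma level_ball_tree: "n < r \<Longrightarrow> level (Suc n) (ball_tree r T) = level (Suc n) T"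
  by (auto simp: level_eq ball_tree_eq)

lemma ball_tree_ball_tree: "n \<le> r \<Longrightarrow> ball_tree n (ball_tree r T) = ball_tree n T"
  by (auto simp: ball_tree_eq)

lemma is_planar_tree_ball_tree:
  assumes "is_planar_tree T" "0 < r"
  shows "is_planar_tree (ball_tree r T)"
  unfolding is_planar_tree_def ball_tree_eq using assms
  by (auto intro: planar_treeD rev_finite_subset[OF planar_tree_finite_children[OF assms(1)]]
      simp: planar_tree_root)

text \<open>Extinction is permanent. This excludes an empty generation n when a nonempty generation
  n + 1 is split by the size of its predecessor.\<close>

lemma card_level_Suc_pos:
  assumes "is_planar_tree T" "card (level (Suc (Suc n)) T) > 0"
  shows "card (level (Suc n) T) > 0"
proof -
  have "level (Suc (Suc n)) T \<noteq> {}" using assms(2) by auto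
  then have "level (Suc n) T \<noteq> {}"
    by (auto simp: level_Suc_eq[OF assms(1)])
  then show ?thesis
    using finite_level[OF assms(1)] by (simp add: card_gt_0_iff)
qed

section \<open>Counting the one-generation extensions of a finite tree\<close>

text \<open>The condition \<open>ball_tree r T = T\<close> only bounds the height by r; for K \<ge>
  1 the height is exactly r.\<close>

definition trees_with_top :: "nat \<Rightarrow> nat \<Rightarrow> nat list set set" where
  "trees_with_top r K =
     {T. is_planar_tree T \<and> finite T \<and> ball_tree r T = T \<and> card (level r T) = K}"

lemma countable_trees_with_top: "countable (trees_with_top r K)"
  by (rule countable_subset[OF _ countable_Collect_finite]) (auto simp: trees_with_top_def)

lemma ball_tree_in_trees_with_top:
  assumes "is_planar_tree T"
  shows "ball_tree (Suc n) T \<in> trees_with_top (Suc n) (card (level (Suc n) T))"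
  using assms
  by (simp add: trees_with_top_def is_planar_tree_ball_tree finite_ball_tree ball_tree_ball_tree
      level_ball_tree)

lemma tree_height_trees_with_top:
  assumes "T \<in> trees_with_top (Suc n) K" "K \<ge> 1"
  shows "tree_height T = Suc n"
proof -
  have "level (Suc n) T \<noteq> {}"
    using assms by (auto simp: trees_with_top_def)
  then obtain v where v: "v \<in> T" "length v = n"
    by (auto simp: level_eq)
  show ?thesis
    unfolding tree_height_def
  proof (rule Max_eqI)
    show "finite (vheight ` T)" using assms by (simp add: trees_with_top_def)
    show "Suc n \<in> vheight ` T" using v by (force simp: vheight_def)
    fix y assume "y \<in> vheight ` T"
    then obtain w where "w \<in> T" "y = Suc (length w)" by (auto simp: vheight_def)
    moreover have "w \<in> ball_tree (Suc n) T"
      using assms \<open>w \<in> T\<close> by (simp add: trees_with_top_def)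
    ultimately show "y \<le> Suc n" by (simp add: ball_tree_eq)
  qed
qed

definition extensions :: "nat \<Rightarrow> nat list set \<Rightarrow> nat \<Rightarrow> nat list set set" where
  "extensions r T0 K' = {T1 \<in> trees_with_top (Suc r) K'. ball_tree r T1 = T0}"

lemma card_extension:
  assumes "T1 \<in> extensions (Suc n) T0 K'"
  shows "card T1 = card T0 + K'"
proof -
  have p: "is_planar_tree T1" and b: "ball_tree (Suc (Suc n)) T1 = T1"
    and "ball_tree (Suc n) T1 = T0" "card (level (Suc (Suc n)) T1) = K'"
    using assms by (auto simp: extensions_def trees_with_top_def)
  then show ?thesis
    using card_ball_tree[OF p, of "Suc (Suc n)"] card_ball_tree[OF p, of "Suc n"] by simp
qed

text \<open>The least number missing from A is its cardinality. Applied to the child indices of a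
  vertex, it shows that the number of children determines which children are present.\<close>

lemma initial_segment_eq_lessThan_card:
  fixes A :: "nat set"
  assumes "finite A" "\<And>j k. k \<in> A \<Longrightarrow> j < k \<Longrightarrow> j \<in> A"
  shows "A = {..<card A}"
proof -
  have "A = {..<m}" if "m = (LEAST m. m \<notin> A)" for m
  proof -
    have ex: "\<exists>m. m \<notin> A" using assms(1) by (meson ex_new_if_finite infinite_UNIV_nat)
    have "m \<notin> A" using LeastI_ex[OF ex] that by simp
    moreover have "\<And>j. j < m \<Longrightarrow> j \<in> A" using not_less_Least that by blast
    moreover have "j < m" if "j \<in> A" for j
      using that assms(2) \<open>m \<notin> A\<close> by (metis linorder_neqE_nat)
    ultimately show ?thesis by auto
  qed
  then show ?thesis by (metis card_lessThan)
qed

text \<open>Stars and bars: an extension amounts to a choice of child counts for the K top vertices,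
  that is, a list of length K with sum K'. The maps \<open>grow\<close> and \<open>counts\<close>
  are mutually inverse between such lists and extensions.\<close>

lemma card_extensions:
  assumes T0: "T0 \<in> trees_with_top (Suc n) K"
  shows "card (extensions (Suc n) T0 K') = (K' + K - 1) choose K'"
    and "finite (extensions (Suc n) T0 K')"
proof -
  have p0: "is_planar_tree T0" and f0: "finite T0" and b0: "\<And>v. v \<in> T0 \<Longrightarrow> length v \<le> n"
    and K: "card (level (Suc n) T0) = K"
    using T0 by (auto simp: trees_with_top_def ball_tree_eq less_Suc_eq_le)
  obtain xs where xs: "set xs = level (Suc n) T0" "distinct xs"
    using finite_distinct_list[OF finite_level[OF p0]] by blast
  have len: "length xs = K" using xs K distinct_card by metis
  have xsn: "i < K \<Longrightarrow> xs ! i \<in> T0 \<and> length (xs ! i) = n" for i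
    using xs(1) len nth_mem[of i xs] by (auto simp: level_eq)
  define L where "L = {l :: nat list. length l = K \<and> sum_list l = K'}"
  define grow where "grow l = T0 \<union> {xs ! i @ [j] |i j. i < K \<and> j < l ! i}" for l :: "nat list"
  define counts where "counts T = map (\<lambda>v. card {j. v @ [j] \<in> T}) xs" for T
  have mem: "v @ [j] \<in> grow l \<longleftrightarrow> (v @ [j] \<in> T0 \<or> (\<exists>i<K. v = xs ! i \<and> j < l ! i))" for v j l
    by (auto simp: grow_def)
  \<comment> \<open>A child of a top vertex has length n + 1, too long to lie in \<open>T0\<close>;
    as \<open>xs\<close> is distinct, the vertex determines its index i.\<close>
  have top: "xs ! i @ [j] \<in> grow l \<longleftrightarrow> j < l ! i" if "i < K" for i j l
  proof -
    have "xs ! i @ [j] \<notin> T0" using b0[of "xs ! i @ [j]"] xsn[OF that] by auto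
    then show ?thesis
      using that xs(2) len nth_eq_iff_index_eq[of xs] by (auto simp: mem)
  qed
  have fin_grow: "finite (grow l)" for l
  proof -
    have "{xs ! i @ [j] |i j. i < K \<and> j < l ! i} = (\<Union>i<K. (\<lambda>j. xs ! i @ [j]) ` {..<l ! i})" by auto
    then show ?thesis using f0 by (simp add: grow_def)
  qed
  have planar_grow: "is_planar_tree (grow l)" for l
    unfolding is_planar_tree_def
  proof (intro conjI allI impI ballI)
    show "[] \<in> grow l" using planar_tree_root[OF p0] by (simp add: grow_def)
    show "v \<in> grow l" if "v @ [k] \<in> grow l" for v k
      using that planar_tree_parent[OF p0] xsn unfolding mem by (auto simp: grow_def)
    show "v @ [j] \<in> grow l" if "v @ [k] \<in> grow l \<and> j < k" for v j k
      using that planar_tree_sibling[OF p0] unfolding mem by fastforce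
    have "(\<lambda>k. v @ [k]) ` {k. v @ [k] \<in> grow l} \<subseteq> grow l" for v by auto
    then show "finite {k. v @ [k] \<in> grow l}" for v
      using fin_grow by (meson finite_imageD finite_subset inj_onI append1_eq_conv)
  qed
  have level_grow: "card (level (Suc (Suc n)) T) = sum_list (counts T)"
    if "is_planar_tree T" "level (Suc n) T = level (Suc n) T0" for T
  proof -
    have "card (level (Suc (Suc n)) T)
        = (\<Sum>v\<in>level (Suc n) T. card ((\<lambda>k. v @ [k]) ` {k. v @ [k] \<in> T}))"
      unfolding level_Suc_eq[OF that(1)]
      by (rule card_UN_disjoint) (use finite_level[OF p0] that planar_tree_finite_children in auto)
    also have "\<dots> = (\<Sum>v\<in>level (Suc n) T. card {k. v @ [k] \<in> T})"
      by (intro sum.cong refl card_image inj_onI) simp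
    also have "\<dots> = sum_list (counts T)"
      unfolding counts_def that(2) xs(1)[symmetric] using xs(2) by (rule sum.distinct_set_conv_list)
    finally show ?thesis .
  qed
  have counts_grow: "counts (grow l) = l" if "length l = K" for l
  proof (rule nth_equalityI)
    show "length (counts (grow l)) = length l" using that len by (simp add: counts_def)
    fix i assume "i < length (counts (grow l))"
    then have i: "i < K" by (simp add: counts_def len)
    then have "{j. xs ! i @ [j] \<in> grow l} = {..<l ! i}" using top by auto
    then show "counts (grow l) ! i = l ! i" using i len by (simp add: counts_def)
  qed
  have ball_grow: "ball_tree (Suc n) (grow l) = T0" for l
    using b0 xsn by (auto simp: ball_tree_eq grow_def less_Suc_eq_le)
  have grow_in: "grow l \<in> extensions (Suc n) T0 K'" if "l \<in> L" for l
  proof -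
    have "level (Suc n) (grow l) = level (Suc n) T0"
      using level_ball_tree[of n "Suc n" "grow l"] ball_grow by simp
    then have "card (level (Suc (Suc n)) (grow l)) = K'"
      using level_grow[OF planar_grow] counts_grow that by (simp add: L_def)
    moreover have "ball_tree (Suc (Suc n)) (grow l) = grow l"
      using b0 xsn by (fastforce simp: ball_tree_eq grow_def less_Suc_eq_le)
    ultimately show ?thesis
      using planar_grow fin_grow ball_grow by (simp add: extensions_def trees_with_top_def)
  qed
  have grow_surj: "counts T \<in> L \<and> grow (counts T) = T" if "T \<in> extensions (Suc n) T0 K'" for T
  proof -
    have p: "is_planar_tree T" and b: "\<And>v. v \<in> T \<Longrightarrow> length v \<le> Suc n"
      and K': "card (level (Suc (Suc n)) T) = K'" and T0_eq: "ball_tree (Suc n) T = T0"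
      using that by (auto simp: extensions_def trees_with_top_def ball_tree_eq less_Suc_eq_le)
    have lev: "level (Suc n) T = level (Suc n) T0"
      using level_ball_tree[of n "Suc n" T] T0_eq by simp
    have children: "{j. v @ [j] \<in> T} = {..<card {j. v @ [j] \<in> T}}" for v
      using planar_treeD[OF p] by (intro initial_segment_eq_lessThan_card) auto
    have nth: "j < counts T ! i \<longleftrightarrow> xs ! i @ [j] \<in> T" if "i < K" for i j
    proof -
      have "counts T ! i = card {j. xs ! i @ [j] \<in> T}"
        using that len by (simp add: counts_def)
      then show ?thesis using children[of "xs ! i"] by (metis lessThan_iff mem_Collect_eq)
    qed
    \<comment> \<open>Up to depth n both trees agree with \<open>T0\<close>. A longer word is
      decided by its parent, a top vertex, and by comparing its last index with the child
      count.\<close>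
    have "w \<in> grow (counts T) \<longleftrightarrow> w \<in> T" for w
    proof (cases "length w \<le> n")
      case True
      then show ?thesis
        using T0_eq xsn by (auto simp: grow_def ball_tree_eq)
    next
      case False
      then obtain v k where w: "w = v @ [k]" by (cases w rule: rev_cases) auto
      have "w \<notin> T0" using False b0 by auto
      then have "w \<in> grow (counts T) \<longleftrightarrow> (\<exists>i<K. v = xs ! i \<and> xs ! i @ [k] \<in> T)"
        unfolding w mem using nth by auto
      also have "\<dots> \<longleftrightarrow> w \<in> T"
      proof
        assume "w \<in> T"
        then have "v \<in> level (Suc n) T"
          using b[of w] False w planar_tree_parent[OF p] by (auto simp: level_eq)
        then show "\<exists>i<K. v = xs ! i \<and> xs ! i @ [k] \<in> T"
          using lev xs(1) len \<open>w \<in> T\<close> w by (metis in_set_conv_nth)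
      qed (auto simp: w)
      finally show ?thesis .
    qed
    then show ?thesis
      using level_grow[OF p lev] K' len by (auto simp: L_def counts_def)
  qed
  have bij: "bij_betw grow L (extensions (Suc n) T0 K')"
    by (rule bij_betw_byWitness[where f' = counts])
       (use grow_in grow_surj counts_grow in \<open>auto simp: L_def\<close>)
  have "finite L"
  proof (rule finite_subset)
    show "L \<subseteq> {l. set l \<subseteq> {..K'} \<and> length l = K}"
      using member_le_sum_list by (fastforce simp: L_def)
    show "finite {l. set l \<subseteq> {..K'} \<and> length l = K}"
      by (rule finite_lists_length_eq) simp
  qed
  then show "finite (extensions (Suc n) T0 K')"
    using bij bij_betw_finite by blast
  show "card (extensions (Suc n) T0 K') = (K' + K - 1) choose K'"
    using bij_betw_same_card[OF bij] card_length_sum_list[of K K'] by (simp add: L_def)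
qed

section \<open>The law of the generation sizes\<close>

abbreviation generation_size :: "nat \<Rightarrow> nat list set \<Rightarrow> nat" where
  "generation_size n T \<equiv> card (level (Suc n) T)"

lemma disjoint_cylinders: "disjoint_family_on (cylinder r) I"
  by (auto simp: disjoint_family_on_def cylinder_def)

text \<open>The union is disjoint and countable, so it serves both to show measurability and to sum
  cylinder probabilities.\<close>

lemma generation_size_eq_UN_cylinder:
  "{T \<in> planar_trees. generation_size n T = K} = (\<Union>T0\<in>trees_with_top (Suc n) K. cylinder (Suc n) T0)"
proof (intro equalityI subsetI)
  fix T assume "T \<in> {T \<in> planar_trees. generation_size n T = K}"
  then show "T \<in> (\<Union>T0\<in>trees_with_top (Suc n) K. cylinder (Suc n) T0)"
    using ball_tree_in_trees_with_top[of T n] by (simp add: cylinder_def planar_trees_def)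
next
  fix T assume "T \<in> (\<Union>T0\<in>trees_with_top (Suc n) K. cylinder (Suc n) T0)"
  then show "T \<in> {T \<in> planar_trees. generation_size n T = K}"
    using level_ball_tree[of n "Suc n" T] by (auto simp: cylinder_def trees_with_top_def)
qed

text \<open>The ball of radius n + 2 determines the ball of radius n + 1, so refining the cylinder
  by one generation runs exactly through the extensions of \<open>T0\<close>.\<close>

lemma cylinder_Int_generation_size:
  assumes "T0 \<in> trees_with_top (Suc n) K"
  shows "cylinder (Suc n) T0 \<inter> {T \<in> planar_trees. generation_size (Suc n) T = K'}
      = (\<Union>T1\<in>extensions (Suc n) T0 K'. cylinder (Suc (Suc n)) T1)"
proof -
  have "ball_tree (Suc n) (ball_tree (Suc (Suc n)) T) = ball_tree (Suc n) T" for T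
    by (rule ball_tree_ball_tree) simp
  then show ?thesis
    unfolding generation_size_eq_UN_cylinder cylinder_def extensions_def by blast
qed

locale nu_space =
  fixes \<mu> :: real and M :: "nat list set measure"
  assumes mu_pos: "\<mu> > 0" and nu: "is_nu \<mu> M"
begin

sublocale prob_space M
  using nu by (simp add: is_nu_def)

lemma space_M: "space M = planar_trees"
  using nu by (simp add: is_nu_def)

lemma cylinder_sets [measurable]: "cylinder r T0 \<in> sets M"
  using nu by (auto simp: is_nu_def cylinders_def intro: sigma_sets.Basic)

lemma measurable_generation_size [measurable]: "generation_size n \<in> measurable M (count_space UNIV)"
proof -
  have "generation_size n -` {K} \<inter> space M \<in> sets M" for K
  proof -
    have "generation_size n -` {K} \<inter> space M = (\<Union>T0\<in>trees_with_top (Suc n) K. cylinder (Suc n) T0)"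
      using generation_size_eq_UN_cylinder[of n K] by (auto simp: space_M)
    then show ?thesis
      using countable_trees_with_top by (auto intro!: sets.countable_UN')
  qed
  then show ?thesis
    by (simp add: measurable_count_space_eq2_countable)
qed

text \<open>\<open>is_nu\<close> prescribes a cylinder only at the height of its tree; K \<ge> 1
  makes that height n + 1, so r - 1 becomes n in the exponent.\<close>

lemma emeasure_cylinder:
  assumes "T0 \<in> trees_with_top (Suc n) K" "K \<ge> 1"
  shows "emeasure M (cylinder (Suc n) T0)
    = ennreal (exp (- \<mu> * real n) * (1/4) ^ card T0 * 2 ^ (K + 1) * lag \<mu> K)"
proof -
  have "measure M (cylinder (tree_height T0) T0) = nu_cyl \<mu> T0"
    using nu assms(1) by (auto simp: is_nu_def trees_with_top_def)
  then show ?thesis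
    using assms(1) tree_height_trees_with_top[OF assms]
    by (simp add: emeasure_eq_measure nu_cyl_def lag_def trees_with_top_def Let_def)
qed

text \<open>Given the ball of radius n + 1, the next generation size depends on that ball only
  through K. The binomial times (1/2)^(K + K') is the transition probability of the critical
  geometric branching process, and exp (-\<mu>) \<open>lag \<mu> K'\<close> /
  \<open>lag \<mu> K\<close> is its Doob factor.\<close>

lemma emeasure_transition:
  assumes "K \<ge> 1" "K' \<ge> 1"
  shows "emeasure M ({T \<in> space M. generation_size n T = K} \<inter> {T \<in> space M. generation_size (Suc n) T = K'})
    = ennreal (exp (- \<mu>) * real ((K' + K - 1) choose K') * (1/2) ^ (K + K') * lag \<mu> K' / lag \<mu> K)
      * emeasure M {T \<in> space M. generation_size n T = K}" (is "emeasure M (?A \<inter> ?B) = ennreal ?q * _")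
proof -
  have lagK: "lag \<mu> K > 0" "lag \<mu> K' > 0" using assms lag_pos mu_pos by auto
  have B: "?B \<in> sets M" by measurable
  have cyl: "emeasure M (cylinder (Suc n) T0 \<inter> ?B) = ennreal ?q * emeasure M (cylinder (Suc n) T0)"
    if T0: "T0 \<in> trees_with_top (Suc n) K" for T0
  proof -
    \<comment> \<open>All extensions with K' new vertices have the same cylinder mass, so their
      number can be factored out.\<close>
    define w where "w = exp (- \<mu> * real (Suc n)) * (1/4) ^ (card T0 + K') * 2 ^ (K' + 1) * lag \<mu> K'"
    have "emeasure M (cylinder (Suc (Suc n)) T1) = ennreal w"
      if "T1 \<in> extensions (Suc n) T0 K'" for T1
      using emeasure_cylinder[of T1 "Suc n" K'] that assms(2) card_extension[OF that]
      by (simp add: extensions_def w_def)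
    then have "emeasure M (cylinder (Suc n) T0 \<inter> ?B) = of_nat (card (extensions (Suc n) T0 K')) * ennreal w"
      unfolding space_M cylinder_Int_generation_size[OF T0]
      by (subst sum_emeasure[symmetric]) (auto simp: disjoint_cylinders card_extensions(2)[OF T0])
    also have "\<dots> = ennreal (real ((K' + K - 1) choose K') * w)"
      by (simp add: card_extensions(1)[OF T0] ennreal_mult' ennreal_of_nat_eq_real_of_nat)
    also have "real ((K' + K - 1) choose K') * w
        = ?q * (exp (- \<mu> * real n) * (1/4) ^ card T0 * 2 ^ (K + 1) * lag \<mu> K)"
    proof -
      have "(4::real) ^ K' = 2 ^ K' * 2 ^ K'" by (simp flip: power_mult_distrib)
      moreover have "exp (- \<mu> * real (Suc n)) = exp (- \<mu>) * exp (- \<mu> * real n)"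
        by (simp add: algebra_simps flip: exp_add)
      ultimately show ?thesis
        using lagK by (simp add: w_def power_add power_divide mult_ac)
    qed
    also have "ennreal \<dots> = ennreal ?q * emeasure M (cylinder (Suc n) T0)"
      unfolding emeasure_cylinder[OF T0 assms(1)] using lagK by (intro ennreal_mult) auto
    finally show ?thesis .
  qed
  have A: "?A = (\<Union>T0\<in>trees_with_top (Suc n) K. cylinder (Suc n) T0)"
    by (simp add: space_M generation_size_eq_UN_cylinder)
  \<comment> \<open>There may be infinitely many trees \<open>T0\<close> with K top vertices, but
    only countably many; their masses are summed by integrating over the counting measure.\<close>
  have "emeasure M (?A \<inter> ?B) = (\<integral>\<^sup>+T0. emeasure M (cylinder (Suc n) T0 \<inter> ?B) \<partial>count_space (trees_with_top (Suc n) K))"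
    unfolding A Int_UN_distrib2 UN_simps(4)[symmetric]
    using B disjoint_cylinders[of "Suc n" "trees_with_top (Suc n) K"] 
    by (subst emeasure_UN_countable[symmetric]) (auto simp: countable_trees_with_top disjoint_family_on_def)
  also have "\<dots> = (\<integral>\<^sup>+T0. ennreal ?q * emeasure M (cylinder (Suc n) T0) \<partial>count_space (trees_with_top (Suc n) K))"
    by (rule nn_integral_cong) (simp add: cyl)
  also have "\<dots> = ennreal ?q * (\<integral>\<^sup>+T0. emeasure M (cylinder (Suc n) T0) \<partial>count_space (trees_with_top (Suc n) K))"
    by (rule nn_integral_cmult) simp
  also have "(\<integral>\<^sup>+T0. emeasure M (cylinder (Suc n) T0) \<partial>count_space (trees_with_top (Suc n) K)) = emeasure M ?A"
    unfolding A by (rule emeasure_UN_countable[symmetric]) (auto simp: countable_trees_with_top disjoint_cylinders)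
  finally show ?thesis .
qed

text \<open>n^(K-1) / (n+1)^(K+1) is the law of the untransformed process started from one vertex;
  the Doob factors telescope to exp (-\<mu> n) \<open>lag \<mu> K\<close>, since
  \<open>lag \<mu> 1\<close> = 1. In the induction step the factor \<open>lag\<close> of the
  predecessor cancels and a negative binomial series remains.\<close>

lemma emeasure_generation_size:
  assumes "K \<ge> 1"
  shows "emeasure M {T \<in> space M. generation_size n T = K}
    = ennreal (exp (- \<mu> * real n) * real n ^ (K - 1) / (real n + 1) ^ (K + 1) * lag \<mu> K)"
  using assms
proof (induction n arbitrary: K)
  case 0
  have "level (Suc 0) T = {[]}" if "T \<in> space M" for T
    using that planar_tree_root by (auto simp: space_M planar_trees_def level_eq)
  then have "{T \<in> space M. generation_size 0 T = K} = (if K = 1 then space M else {})"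
    by auto
  \<comment> \<open>With 0^0 = 1 the formula is the point mass at K = 1.\<close>
  then show ?case
    using 0 by (auto simp: emeasure_space_1 lag_def power_0_left)
next
  case (Suc n K')
  \<comment> \<open>z collects what is raised to the power j: 1/2 from the transition and n / (n +
    1) from the induction hypothesis. The factors free of j go into c.\<close>
  define z where "z = real n / (2 * (real n + 1))"
  define c where "c = exp (- \<mu> * real (Suc n)) * lag \<mu> K' * (1/2) ^ (K' + 1) / (real n + 1) ^ 2"
  have z: "0 \<le> z" "z < 1" and z1: "1 - z = (real n + 2) / (2 * (real n + 1))"
    by (simp_all add: z_def field_simps)
  have c: "c \<ge> 0" using lag_nonneg mu_pos by (simp add: c_def)
  let ?B = "{T \<in> space M. generation_size (Suc n) T = K'}"
  let ?A = "\<lambda>j. {T \<in> space M. generation_size n T = Suc j}"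
  have "?B = (\<Union>j. ?A j \<inter> ?B)"
    using Suc.prems card_level_Suc_pos[of _ n]
    by (fastforce simp: space_M planar_trees_def gr0_conv_Suc)
  then have "emeasure M ?B = emeasure M (\<Union>j. ?A j \<inter> ?B)" by simp
  also have "\<dots> = (\<Sum>j. emeasure M (?A j \<inter> ?B))"
    by (rule suminf_emeasure[symmetric]) (auto simp: disjoint_family_on_def)
  also have "\<dots> = (\<Sum>j. ennreal (c * (real ((j + K') choose K') * z ^ j)))"
  proof (rule suminf_cong)
    fix j
    have lagj: "lag \<mu> (Suc j) > 0" "lag \<mu> K' \<ge> 0" using lag_pos lag_nonneg mu_pos by auto
    have "emeasure M (?A j \<inter> ?B) = ennreal (exp (- \<mu>) * real ((K' + j) choose K') * (1/2) ^ (Suc j + K')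
            * lag \<mu> K' / lag \<mu> (Suc j))
         * ennreal (exp (- \<mu> * real n) * real n ^ j / (real n + 1) ^ (j + 2) * lag \<mu> (Suc j))"
      using emeasure_transition[of "Suc j" K' n] Suc.prems Suc.IH[of "Suc j"] by simp
    also have "\<dots> = ennreal ((exp (- \<mu>) * real ((K' + j) choose K') * (1/2) ^ (Suc j + K')
            * lag \<mu> K' / lag \<mu> (Suc j))
         * (exp (- \<mu> * real n) * real n ^ j / (real n + 1) ^ (j + 2) * lag \<mu> (Suc j)))"
      using lagj by (intro ennreal_mult[symmetric]) auto
    also have "(exp (- \<mu>) * real ((K' + j) choose K') * (1/2) ^ (Suc j + K')
            * lag \<mu> K' / lag \<mu> (Suc j))
         * (exp (- \<mu> * real n) * real n ^ j / (real n + 1) ^ (j + 2) * lag \<mu> (Suc j))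
       = c * (real ((j + K') choose K') * z ^ j)"
    proof -
      have "exp (- \<mu> * real (Suc n)) = exp (- \<mu>) * exp (- \<mu> * real n)"
        by (simp add: algebra_simps flip: exp_add)
      moreover have "z ^ j = real n ^ j / (2 ^ j * (real n + 1) ^ j)"
        unfolding z_def by (simp only: power_divide power_mult_distrib)
      ultimately show ?thesis
        using lagj
        by (simp add: c_def power_add power_divide power2_eq_square mult_ac add.commute[of j K'])
    qed
    finally show "emeasure M (?A j \<inter> ?B) = ennreal (c * (real ((j + K') choose K') * z ^ j))" .
  qed
  also have "\<dots> = ennreal (c * (1 / (1 - z) ^ Suc K'))"
    using z c by (intro suminf_ennreal_eq sums_mult negative_binomial_sums) auto
  also have "c * (1 / (1 - z) ^ Suc K')
      = exp (- \<mu> * real (Suc n)) * real (Suc n) ^ (K' - 1) / (real (Suc n) + 1) ^ (K' + 1) * lag \<mu> K'"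
  proof -
    obtain k where k: "K' = Suc k" using Suc.prems by (cases K') auto
    have "1 / (1 - z) ^ Suc K' = 2 ^ Suc K' * (real n + 1) ^ Suc K' / (real n + 2) ^ Suc K'"
      unfolding z1 by (simp only: power_divide power_mult_distrib divide_divide_eq_right mult_1)
    moreover have "real (Suc n) = real n + 1" "real n + 1 + 1 = real n + 2"
      by simp_all
    ultimately show ?thesis
      unfolding c_def k by (simp only:) (simp add: power_divide power2_eq_square)
  qed
  finally show ?case .
qed

section \<open>Generating function and exponential tail bounds\<close>

definition pgf :: "nat \<Rightarrow> real \<Rightarrow> real" where
  "pgf n s = exp (- \<mu> * real n) * s / (real n + 1 - real n * s) ^ 2
     * exp (\<mu> * real n * s / (real n + 1 - real n * s))"

text \<open>The substitution x = n s / (n + 1) reduces this to the Laguerre generating function. The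
  admissible range goes beyond s = 1, which makes an exponential bound on the upper tail
  possible.\<close>

lemma pgf_generation_size:
  assumes "s > 0" "real n * s < real n + 1"
  shows "(\<Sum>j. ennreal (s ^ Suc j) * emeasure M {T \<in> space M. generation_size n T = Suc j}) = ennreal (pgf n s)"
proof -
  define x where "x = real n * s / (real n + 1)"
  have x: "0 \<le> x" "x < 1" and x1: "1 - x = (real n + 1 - real n * s) / (real n + 1)"
    using assms by (auto simp: x_def field_simps)
  define c where "c = exp (- \<mu> * real n) * s / (real n + 1) ^ 2"
  have c: "c \<ge> 0" using assms by (simp add: c_def)
  have "ennreal (s ^ Suc j) * emeasure M {T \<in> space M. generation_size n T = Suc j}
      = ennreal c * ennreal (x ^ j * lag \<mu> (Suc j))" for j
  proof -
    have "s ^ Suc j * (exp (- \<mu> * real n) * real n ^ (Suc j - 1) / (real n + 1) ^ (Suc j + 1) * lag \<mu> (Suc j))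
       = c * (x ^ j * lag \<mu> (Suc j))"
      by (simp add: c_def x_def power_divide power_mult_distrib power2_eq_square mult_ac)
    then show ?thesis
      using assms c x lag_nonneg[of \<mu>] mu_pos
      by (subst emeasure_generation_size) (auto simp flip: ennreal_mult simp del: power_Suc)
  qed
  then have "(\<Sum>j. ennreal (s ^ Suc j) * emeasure M {T \<in> space M. generation_size n T = Suc j})
      = ennreal c * ennreal (exp (\<mu> * x / (1 - x)) / (1 - x) ^ 2)"
    using lag_generating_function[of \<mu> x] x mu_pos by simp
  also have "\<dots> = ennreal (c * (exp (\<mu> * x / (1 - x)) / (1 - x) ^ 2))"
    using c by (intro ennreal_mult[symmetric]) auto
  also have "c * (exp (\<mu> * x / (1 - x)) / (1 - x) ^ 2) = pgf n s"
  proof -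
    have "\<mu> * x / (1 - x) = \<mu> * real n * s / (real n + 1 - real n * s)"
      unfolding x1 by (simp add: x_def)
    then show ?thesis
      unfolding pgf_def c_def x1 by (simp add: power_divide)
  qed
  finally show ?thesis .
qed

text \<open>\<open>pgf n 1\<close> = 1, so the positive sizes already carry the whole mass.\<close>

lemma AE_generation_size_pos: "AE T in M. generation_size n T \<ge> 1"
proof -
  let ?A = "\<lambda>j. {T \<in> space M. generation_size n T = Suc j}"
  have "emeasure M (\<Union>j. ?A j) = (\<Sum>j. emeasure M (?A j))"
    by (rule suminf_emeasure[symmetric]) (auto simp: disjoint_family_on_def)
  also have "\<dots> = 1"
    using pgf_generation_size[of 1 n] by (simp add: pgf_def flip: exp_add)
  finally have "emeasure M (\<Union>j. ?A j) = 1" .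
  then have "AE T in M. T \<in> (\<Union>j. ?A j)"
    by (intro AE_in_set_eq_1[THEN iffD2]) (auto simp: emeasure_eq_measure)
  then show ?thesis
    by eventually_elim auto
qed

text \<open>Markov's inequality for c s^Z, stated for a predicate P so that it covers the lower tail
  (s < 1) and the upper tail (s > 1) alike. The event asks for size at least 1 because the series
  for \<open>pgf\<close> starts there.\<close>

lemma chernoff_bound:
  assumes s: "s > 0" "real n * s < real n + 1" and c: "c \<ge> 0"
    and P: "\<And>K. P K \<Longrightarrow> 1 \<le> c * s ^ K"
  shows "prob {T \<in> space M. generation_size n T \<ge> 1 \<and> P (generation_size n T)} \<le> c * pgf n s"
proof -
  let ?A = "\<lambda>j. {T \<in> space M. generation_size n T = Suc j}"
  let ?E = "{T \<in> space M. generation_size n T \<ge> 1 \<and> P (generation_size n T)}"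
  have "?E = (\<Union>j. if P (Suc j) then ?A j else {})"
    by (auto simp: Suc_le_eq gr0_conv_Suc split: if_splits)
  then have "emeasure M ?E = emeasure M (\<Union>j. if P (Suc j) then ?A j else {})" by simp
  also have "\<dots> = (\<Sum>j. emeasure M (if P (Suc j) then ?A j else {}))"
    by (rule suminf_emeasure[symmetric]) (auto simp: disjoint_family_on_def)
  also have "\<dots> \<le> (\<Sum>j. ennreal c * (ennreal (s ^ Suc j) * emeasure M (?A j)))"
  proof (rule suminf_le)
    fix j
    have "1 * emeasure M (?A j) \<le> ennreal (c * s ^ Suc j) * emeasure M (?A j)" if "P (Suc j)"
      using P[OF that] by (intro mult_right_mono) (auto simp del: power_Suc)
    then show "emeasure M (if P (Suc j) then ?A j else {})
        \<le> ennreal c * (ennreal (s ^ Suc j) * emeasure M (?A j))"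
      using c s by (auto simp: ennreal_mult mult.assoc simp del: power_Suc)
  qed auto
  also have "\<dots> = ennreal (c * pgf n s)"
    using pgf_generation_size[OF s] c by (simp add: ennreal_mult' del: power_Suc)
  finally show ?thesis
    using c s by (simp add: emeasure_eq_measure pgf_def)
qed

text \<open>At s = n / (n + 1) the second exponent in \<open>pgf\<close> is \<mu> n^2 / (2n + 1)
  \<le> \<mu> n / 2, so \<open>pgf n s\<close> \<le> exp (-\<mu> n / 2). The threshold \<mu> n^2 / 4
  costs a factor exp (\<mu> n / 4), half of this gain.\<close>

lemma prob_small_generation:
  "prob {T \<in> space M. generation_size n T \<ge> 1 \<and> real (generation_size n T) \<le> \<mu> / 4 * real n ^ 2}
     \<le> exp (- \<mu> / 4) ^ n"
proof (cases "n = 0")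
  case False
  then have n: "real n > 0" by simp
  define s where "s = real n / (real n + 1)"
  have s: "s > 0" "s \<le> 1" using n by (auto simp: s_def)
  have d: "real n + 1 - real n * s = (2 * real n + 1) / (real n + 1)"
    using n by (simp add: s_def field_simps)
  \<comment> \<open>s is the inverse of 1 + 1/n, which is at most exp (1/n). Hence s^K \<ge> exp
    (-K/n), at least exp (-\<mu> n / 4) below the threshold.\<close>
  have "exp (- (1 / real n)) \<le> s"
  proof -
    have "1 + 1 / real n \<le> exp (1 / real n)" by (rule exp_ge_add_one_self)
    then have "inverse (exp (1 / real n)) \<le> inverse (1 + 1 / real n)"
      using n by (intro le_imp_inverse_le) (auto intro: add_pos_pos)
    also have "inverse (1 + 1 / real n) = s" using n by (simp add: s_def field_simps)
    finally show ?thesis by (simp add: exp_minus)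
  qed
  have "prob {T \<in> space M. generation_size n T \<ge> 1 \<and> real (generation_size n T) \<le> \<mu> / 4 * real n ^ 2}
      \<le> exp (\<mu> / 4 * real n) * pgf n s"
  proof (rule chernoff_bound)
    show "real n * s < real n + 1"
      using s n by (simp add: mult_left_le order_le_less_trans[of _ "real n"])
    fix K assume K: "real K \<le> \<mu> / 4 * real n ^ 2"
    have "real K / real n \<le> \<mu> / 4 * real n"
      using K n by (simp add: divide_le_eq power2_eq_square)
    then have "1 \<le> exp (\<mu> / 4 * real n) * exp (- (real K / real n))"
      by (simp flip: exp_add)
    also have "exp (- (real K / real n)) = exp (- (1 / real n)) ^ K"
      by (simp flip: exp_of_nat_mult)
    also have "\<dots> \<le> s ^ K"
      using \<open>exp (- (1 / real n)) \<le> s\<close> by (intro power_mono) auto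
    finally show "1 \<le> exp (\<mu> / 4 * real n) * s ^ K" by simp
  qed (use s in auto)
  also have "pgf n s \<le> exp (- \<mu> * real n) * exp (\<mu> * (real n / 2))"
  proof -
    have "s / (real n + 1 - real n * s) ^ 2 \<le> 1"
    proof -
      have "1 \<le> real n + 1 - real n * s" using s n by (simp add: mult_left_le)
      then have "1 \<le> (real n + 1 - real n * s) ^ 2" by simp
      then show ?thesis using s by (simp add: divide_le_eq_1)
    qed
    moreover have "exp (\<mu> * real n * s / (real n + 1 - real n * s)) \<le> exp (\<mu> * (real n / 2))"
    proof -
      have "real n / 2 * (real n + 1 - real n * s) = s * (real n + 1 / 2)"
        unfolding d using n by (simp add: s_def field_simps)
      then have "real n * s \<le> real n / 2 * (real n + 1 - real n * s)"
        using s by (simp add: algebra_simps)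
      moreover have "real n + 1 - real n * s > 0"
        unfolding d using n by simp
      ultimately have "real n * s / (real n + 1 - real n * s) \<le> real n / 2"
        by (simp add: pos_divide_le_eq)
      then show ?thesis
        using mu_pos mult_left_mono[of "real n * s / (real n + 1 - real n * s)" "real n / 2" \<mu>]
        by (simp add: mult.assoc)
    qed
    ultimately have "s / (real n + 1 - real n * s) ^ 2 * exp (\<mu> * real n * s / (real n + 1 - real n * s))
        \<le> 1 * exp (\<mu> * (real n / 2))"
      by (intro mult_mono) auto
    then show ?thesis
      unfolding pgf_def by (simp add: mult.assoc flip: times_divide_eq_right)
  qed
  also have "exp (\<mu> / 4 * real n) * (exp (- \<mu> * real n) * exp (\<mu> * (real n / 2))) = exp (- \<mu> / 4) ^ n"
    by (simp add: algebra_simps flip: exp_add exp_of_nat_mult)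
  finally show ?thesis by simp
qed simp

text \<open>At s = 1 + 1/(2n), halfway to the singularity 1 + 1/n, the denominator n + 1 - n s is
  1/2 and \<open>pgf\<close> grows like exp (\<mu> n). The choice of D makes s^K \<ge> exp (2 \<mu>
  n) above the threshold, which leaves a decay of exp (-\<mu> n).\<close>

lemma prob_large_generation:
  fixes D :: nat
  assumes D: "exp (2 * \<mu>) \<le> 2 ^ D"
  shows "prob {T \<in> space M. generation_size n T \<ge> 1 \<and> 2 * D * n ^ 2 \<le> generation_size n T}
     \<le> 6 * exp \<mu> * exp (- \<mu>) ^ n"
proof (cases "n = 0")
  case False
  then have n: "real n > 0" by simp
  define s where "s = 1 + 1 / (2 * real n)"
  have s: "s > 0" "s \<le> 3 / 2" "s \<ge> 1" using n False by (auto simp: s_def field_simps intro: add_pos_pos)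
  have ns: "real n * s = real n + 1 / 2" using n by (simp add: s_def field_simps)
  have "prob {T \<in> space M. generation_size n T \<ge> 1 \<and> 2 * D * n ^ 2 \<le> generation_size n T}
      \<le> exp (- 2 * \<mu> * real n) * pgf n s"
  proof (rule chernoff_bound)
    fix K assume K: "2 * D * n ^ 2 \<le> K"
    have "- 1 \<le> 1 / (2 * real n)" by (rule order_trans[of _ 0]) auto
    \<comment> \<open>Bernoulli's inequality: 2n factors, each exceeding 1 by 1/(2n).\<close>
    then have "2 \<le> s ^ (2 * n)"
      using Bernoulli_inequality[of "1 / (2 * real n)" "2 * n"] n by (simp add: s_def)
    have "exp (2 * \<mu> * real n) = exp (2 * \<mu>) ^ n"
      unfolding exp_of_nat_mult[symmetric] by (simp add: mult_ac)
    also have "\<dots> \<le> (2 ^ D) ^ n" using D by (intro power_mono) auto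
    also have "\<dots> \<le> ((s ^ (2 * n)) ^ D) ^ n"
      using \<open>2 \<le> s ^ (2 * n)\<close> by (intro power_mono) auto
    also have "\<dots> = s ^ (2 * D * n ^ 2)"
      unfolding power_mult[symmetric] by (simp add: power2_eq_square mult_ac)
    also have "\<dots> \<le> s ^ K"
      using K s by (intro power_increasing) auto
    finally have "exp (- 2 * \<mu> * real n) * exp (2 * \<mu> * real n) \<le> exp (- 2 * \<mu> * real n) * s ^ K"
      by (intro mult_left_mono) auto
    then show "1 \<le> exp (- 2 * \<mu> * real n) * s ^ K"
      by (simp flip: exp_add)
  qed (use s ns in auto)
  also have "pgf n s = 4 * s * (exp (- \<mu> * real n) * exp (2 * \<mu> * (real n + 1 / 2)))"
    unfolding pgf_def mult.assoc[of \<mu> "real n" s] ns by (simp add: power2_eq_square mult_ac)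
  also have "\<dots> \<le> 6 * (exp (- \<mu> * real n) * exp (2 * \<mu> * (real n + 1 / 2)))"
    using s by (intro mult_right_mono) auto
  also have "exp (- 2 * \<mu> * real n) * (6 * (exp (- \<mu> * real n) * exp (2 * \<mu> * (real n + 1 / 2))))
      = 6 * exp \<mu> * exp (- \<mu>) ^ n"
    by (simp add: algebra_simps flip: exp_add exp_of_nat_mult)
  finally show ?thesis by simp
next
  case True
  have "1 \<le> exp \<mu>" using mu_pos by simp
  then have "1 \<le> 6 * exp \<mu>" by linarith
  then show ?thesis using True order_trans[OF prob_le_1] by simp
qed

section \<open>Almost sure quadratic growth of the generations\<close>

text \<open>Both tail bounds are summable in n, so by Borel--Cantelli almost surely only finitely
  many tail events occur. These events include size at least 1, a condition met almost surely for
  all n at once.\<close>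

lemma AE_generation_size_quadratic:
  "\<exists>c C. c > 0 \<and> C > 0 \<and> (AE T in M. \<forall>\<^sub>F n in sequentially.
      c * real n ^ 2 \<le> real (generation_size n T) \<and> real (generation_size n T) \<le> C * real n ^ 2)"
proof -
  obtain D :: nat where D: "exp (2 * \<mu>) < 2 ^ D"
    using real_arch_pow[of 2 "exp (2 * \<mu>)"] by auto
  have "exp (2 * \<mu>) > 1" using mu_pos by simp
  with D have "D > 0" by (cases D) auto
  have geometric: "summable (\<lambda>n. exp (- x) ^ n)" if "x > 0" for x :: real
    using that by (intro summable_geometric) simp
  have "summable (\<lambda>n. prob {T \<in> space M. generation_size n T \<ge> 1
      \<and> real (generation_size n T) \<le> \<mu> / 4 * real n ^ 2})"
    using mu_pos prob_small_generation
    by (intro summable_comparison_test'[OF geometric[of "\<mu> / 4"]]) simp_all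
  then have small: "AE T in M. \<forall>\<^sub>F n in sequentially. T \<in> space M -
      {T \<in> space M. generation_size n T \<ge> 1 \<and> real (generation_size n T) \<le> \<mu> / 4 * real n ^ 2}"
    by (intro borel_cantelli_AE1) (simp_all add: emeasure_eq_measure)
  have "summable (\<lambda>n. prob {T \<in> space M. generation_size n T \<ge> 1
      \<and> 2 * D * n ^ 2 \<le> generation_size n T})"
  proof (rule summable_comparison_test')
    show "summable (\<lambda>n. 6 * exp \<mu> * exp (- \<mu>) ^ n)"
      using mu_pos by (intro summable_mult geometric)
    show "norm (prob {T \<in> space M. generation_size n T \<ge> 1 \<and> 2 * D * n ^ 2 \<le> generation_size n T})
        \<le> 6 * exp \<mu> * exp (- \<mu>) ^ n" for n
      using prob_large_generation[OF less_imp_le[OF D], of n] by (simp only: real_norm_def abs_of_nonneg measure_nonneg)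
  qed
  then have large: "AE T in M. \<forall>\<^sub>F n in sequentially. T \<in> space M -
      {T \<in> space M. generation_size n T \<ge> 1 \<and> 2 * D * n ^ 2 \<le> generation_size n T}"
    by (intro borel_cantelli_AE1) (simp_all add: emeasure_eq_measure)
  have pos: "AE T in M. \<forall>n. generation_size n T \<ge> 1"
    using AE_generation_size_pos by (simp add: AE_all_countable)
  have "AE T in M. \<forall>\<^sub>F n in sequentially.
      \<mu> / 4 * real n ^ 2 \<le> real (generation_size n T) \<and> real (generation_size n T) \<le> real (2 * D) * real n ^ 2"
    using small large pos
  proof eventually_elim
    case (elim T)
    from elim(1,2) show ?case
    proof eventually_elim
      case (elim n)
      then have "generation_size n T \<le> 2 * D * n ^ 2"
        using \<open>\<forall>n. generation_size n T \<ge> 1\<close> by auto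
      then have "real (generation_size n T) \<le> real (2 * D * n ^ 2)"
        by (simp only: of_nat_le_iff)
      then show ?case
        using elim \<open>\<forall>n. generation_size n T \<ge> 1\<close> by auto
    qed
  qed
  then show ?thesis
    using mu_pos \<open>D > 0\<close> by (intro exI[of _ "\<mu> / 4"] exI[of _ "real (2 * D)"]) auto
qed

end

section \<open>From quadratic terms to cubic sums and the logarithmic limit\<close>

lemma sum_lower_cubic:
  fixes z :: "nat \<Rightarrow> real"
  assumes nonneg: "\<And>n. z n \<ge> 0" and c: "c > 0"
    and ev: "\<forall>\<^sub>F n in sequentially. c * real n ^ 2 \<le> z n"
  shows "\<forall>\<^sub>F r in sequentially. c / 18 * real r ^ 3 \<le> (\<Sum>n<r. z n)"
proof -
  obtain n0 where n0: "\<And>n. n \<ge> n0 \<Longrightarrow> c * real n ^ 2 \<le> z n"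
    using ev by (auto simp: eventually_sequentially)
  have "c / 18 * real r ^ 3 \<le> (\<Sum>n<r. z n)" if r: "r \<ge> 2 * n0 + 2" for r
  proof -
    \<comment> \<open>Only the terms from m on are kept: at least r/2 of them, each at least c
      (r/3)^2, whence the constant c/18. The bound r/3 \<le> m holds from r = 2 on.\<close>
    define m where "m = r div 2"
    have "m \<ge> n0" "r \<le> 3 * m" "r \<le> 2 * (r - m)"
      using r unfolding m_def by presburger+
    then have m: "m \<ge> n0" "real r / 3 \<le> real m" "real r / 2 \<le> real (r - m)"
      by linarith+
    have "c / 18 * real r ^ 3 = (real r / 2) * (c * (real r / 3) ^ 2)"
      by (simp add: power2_eq_square power3_eq_cube)
    also have "\<dots> \<le> real (r - m) * (c * real m ^ 2)"
      using m c by (intro mult_mono power_mono) auto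
    also have "\<dots> = (\<Sum>n\<in>{m..<r}. c * real m ^ 2)" by simp
    also have "\<dots> \<le> (\<Sum>n\<in>{m..<r}. z n)"
    proof (rule sum_mono)
      fix n assume "n \<in> {m..<r}"
      then have "c * real m ^ 2 \<le> c * real n ^ 2"
        using c by (intro mult_left_mono power_mono) auto
      also have "\<dots> \<le> z n" using n0 m \<open>n \<in> {m..<r}\<close> by auto
      finally show "c * real m ^ 2 \<le> z n" .
    qed
    also have "\<dots> \<le> (\<Sum>n<r. z n)"
      by (rule sum_mono2) (auto simp: nonneg)
    finally show ?thesis .
  qed
  then show ?thesis
    unfolding eventually_sequentially by blast
qed

lemma sum_upper_cubic:
  fixes z :: "nat \<Rightarrow> real"
  assumes nonneg: "\<And>n. z n \<ge> 0" and C: "C > 0"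
    and ev: "\<forall>\<^sub>F n in sequentially. z n \<le> C * real n ^ 2"
  shows "\<forall>\<^sub>F r in sequentially. (\<Sum>n<r. z n) \<le> (C + 1) * real r ^ 3"
proof -
  obtain n0 where n0: "\<And>n. n \<ge> n0 \<Longrightarrow> z n \<le> C * real n ^ 2"
    using ev by (auto simp: eventually_sequentially)
  define B where "B = (\<Sum>n<n0. z n)"
  have "(\<Sum>n<r. z n) \<le> (C + 1) * real r ^ 3" if r: "r \<ge> max 1 (nat \<lceil>B\<rceil>)" for r
  proof -
    \<comment> \<open>A union rather than a split of the range, since r may be smaller than
      \<open>n0\<close>. The initial part \<open>B\<close> does not depend on r and is absorbed by
      r^3, whence C + 1.\<close>
    have "(\<Sum>n<r. z n) \<le> (\<Sum>n\<in>{..<n0} \<union> {n0..<r}. z n)"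
      by (rule sum_mono2) (auto simp: nonneg)
    also have "\<dots> = B + (\<Sum>n\<in>{n0..<r}. z n)"
      unfolding B_def by (rule sum.union_disjoint) auto
    also have "(\<Sum>n\<in>{n0..<r}. z n) \<le> (\<Sum>n\<in>{n0..<r}. C * real r ^ 2)"
    proof (rule sum_mono)
      fix n assume n: "n \<in> {n0..<r}"
      then have "z n \<le> C * real n ^ 2" using n0 by simp
      also have "\<dots> \<le> C * real r ^ 2" using n C by (intro mult_left_mono power_mono) auto
      finally show "z n \<le> C * real r ^ 2" .
    qed
    also have "\<dots> \<le> real r * (C * real r ^ 2)"
      using C by (simp add: mult_right_mono)
    also have "B \<le> real r ^ 3"
    proof -
      have "B \<le> real r" using r by linarith
      also have "real r \<le> real r ^ 3" using r by (intro self_le_power) auto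
      finally show ?thesis .
    qed
    finally show ?thesis by (simp add: power2_eq_square power3_eq_cube algebra_simps)
  qed
  then show ?thesis
    unfolding eventually_sequentially by blast
qed

text \<open>Constant factors contribute only ln a / ln r, which tends to 0, so both bounds squeeze
  the ratio to k.\<close>

lemma ln_ratio_tendsto:
  fixes b :: "nat \<Rightarrow> real"
  assumes "c > 0" "C > 0"
    and lower: "\<forall>\<^sub>F r in sequentially. c * real r ^ k \<le> b r"
    and upper: "\<forall>\<^sub>F r in sequentially. b r \<le> C * real r ^ k"
  shows "(\<lambda>r. ln (b r) / ln (real r)) \<longlonglongrightarrow> real k"
proof (rule tendsto_sandwich)
  have ln_top: "filterlim (\<lambda>r. ln (real r)) at_top sequentially"
    by (rule filterlim_compose[OF ln_at_top filterlim_real_sequentially])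
  have lim: "(\<lambda>r. ln a / ln (real r) + real k) \<longlonglongrightarrow> real k" for a :: real
    using tendsto_add[OF real_tendsto_divide_at_top[OF tendsto_const ln_top] tendsto_const, of "ln a" "real k"]
    by simp
  show "(\<lambda>r. ln c / ln (real r) + real k) \<longlonglongrightarrow> real k" "(\<lambda>r. ln C / ln (real r) + real k) \<longlonglongrightarrow> real k"
    by (rule lim)+
  have ln_eq: "ln (a * real r ^ k) / ln (real r) = ln a / ln (real r) + real k"
    if "a > 0" "r \<ge> 2" for a :: real and r
    using that by (simp add: ln_mult ln_realpow add_divide_distrib)
  show "\<forall>\<^sub>F r in sequentially. ln c / ln (real r) + real k \<le> ln (b r) / ln (real r)"
    using lower eventually_ge_at_top[of 2]
  proof eventually_elim
    case (elim r)
    have "0 < c * real r ^ k" using elim assms by simp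
    then have "ln (c * real r ^ k) \<le> ln (b r)" using elim by simp
    then have "ln (c * real r ^ k) / ln (real r) \<le> ln (b r) / ln (real r)"
      using elim by (intro divide_right_mono) auto
    then show ?case using ln_eq[of c r] elim assms by simp
  qed
  show "\<forall>\<^sub>F r in sequentially. ln (b r) / ln (real r) \<le> ln C / ln (real r) + real k"
    using lower upper eventually_ge_at_top[of 2]
  proof eventually_elim
    case (elim r)
    \<comment> \<open>The lower bound enters here too: it makes b r positive, so that the logarithm
      preserves the upper bound.\<close>
    have "0 < c * real r ^ k" using elim assms by simp
    then have "ln (b r) \<le> ln (C * real r ^ k)" using elim by simp
    then have "ln (b r) / ln (real r) \<le> ln (C * real r ^ k) / ln (real r)"
      using elim by (intro divide_right_mono) auto
    then show ?case using ln_eq[of C r] elim assms by simp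
  qed
qed

section \<open>Cubic volume growth of balls\<close>

theorem mainTheorem19:
  fixes \<mu> :: real and M :: "nat list set measure"
  assumes "\<mu> > 0" and "is_nu \<mu> M"
  shows "(\<exists>C1 C2 :: real. C1 > 0 \<and> C2 > 0 \<and>
           (AE T in M. \<exists>r0::nat. \<forall>r\<ge>r0.
              C1 * real r ^ 3 \<le> real (card (ball_tree r T)) \<and>
              real (card (ball_tree r T)) \<le> C2 * real r ^ 3 * ln (real r)))
       \<and> (AE T in M. (\<lambda>r. ln (real (card (ball_tree r T))) / ln (real r)) \<longlonglongrightarrow> 3)"
proof -
  interpret nu_space \<mu> M
    using assms by unfold_locales
  obtain c C where c: "c > 0" and C: "C > 0"
    and quad: "AE T in M. \<forall>\<^sub>F n in sequentially.
      c * real n ^ 2 \<le> real (generation_size n T) \<and> real (generation_size n T) \<le> C * real n ^ 2"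
    using AE_generation_size_quadratic by blast
  have cubic: "AE T in M. (\<forall>\<^sub>F r in sequentially. c / 18 * real r ^ 3 \<le> real (card (ball_tree r T)))
      \<and> (\<forall>\<^sub>F r in sequentially. real (card (ball_tree r T)) \<le> (C + 1) * real r ^ 3)"
    using quad AE_space
  proof eventually_elim
    case (elim T)
    then have "real (card (ball_tree r T)) = (\<Sum>n<r. real (generation_size n T))" for r
      by (simp add: card_ball_tree space_M planar_trees_def)
    then show ?case
      using elim(1) c C sum_lower_cubic[of "\<lambda>n. real (generation_size n T)" c]
        sum_upper_cubic[of "\<lambda>n. real (generation_size n T)" C]
      by (simp add: eventually_conj_iff)
  qed
  have "AE T in M. \<exists>r0::nat. \<forall>r\<ge>r0.
      c / 18 * real r ^ 3 \<le> real (card (ball_tree r T)) \<and>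
      real (card (ball_tree r T)) \<le> (C + 1) * real r ^ 3 * ln (real r)"
    using cubic
  proof eventually_elim
    case (elim T)
    have "\<forall>\<^sub>F r in sequentially. c / 18 * real r ^ 3 \<le> real (card (ball_tree r T)) \<and>
      real (card (ball_tree r T)) \<le> (C + 1) * real r ^ 3 * ln (real r)"
      using conjunct1[OF elim] conjunct2[OF elim] eventually_ge_at_top[of 3]
    proof eventually_elim
      case (elim r)
      \<comment> \<open>The upper bound already holds without the logarithm; from r = 3 on ln r
        \<ge> 1, so the factor only weakens it.\<close>
      have "exp 1 \<le> real r"
        using exp_le elim(3) by linarith
      then have "1 \<le> ln (real r)"
        using elim(3) by (subst ln_ge_iff) auto
      then have "(C + 1) * real r ^ 3 * 1 \<le> (C + 1) * real r ^ 3 * ln (real r)"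
        using C by (intro mult_left_mono) auto
      then show ?case using elim by linarith
    qed
    then show ?case by (simp add: eventually_sequentially)
  qed
  moreover have "AE T in M. (\<lambda>r. ln (real (card (ball_tree r T))) / ln (real r)) \<longlonglongrightarrow> 3"
    using cubic
  proof eventually_elim
    case (elim T)
    then show ?case
      using ln_ratio_tendsto[of "c / 18" "C + 1" 3 "\<lambda>r. real (card (ball_tree r T))"] c C by simp
  qed
  ultimately show ?thesis
    using c C by (intro conjI exI[of _ "c / 18"] exI[of _ "C + 1"]) auto
qed

end
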